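(* Let $0<\nu\le 1$, and let $\mathbf z_D$ and $\mathbf z_A$ be the positions of the defender and the intruder, with $\phi_D>0$. If the defender continues to move towards the (current) optimal breaching point at its maximum speed $1$, then $p(\mathbf z_D,\mathbf z_A,\mathbf z_B)$, evaluated along the play with $\mathbf z_B$ the current optimal breaching point, decreases or stays the same, regardless of the intruder's behavior.
   Context: Setting. The target is a hemisphere of unit radius centered at the origin $O$ standing on a ground plane; its boundary on the ground is the unit circle (the perimeter). The defender $D$ moves on the hemisphere with first-order dynamics and maximum speed $1$; the intruder $A$ moves on the ground plane outside the unit circle with first-order dynamics and maximum speed $\nu\in(0,1]$. Positions are in spherical coordinates [azimuth, elevation, radius], $\mathbf z_D=[\psi_D,\phi_D,1]$ with $\phi_D\in[0,\pi/2]$ and $\mathbf z_A=[\psi_A,0,r]$, $r>1$; put $\psi=\psi_A-\psi_D$. Measuring azimuth relative to the defender, $\mathbf z_D=[0,\phi_D,1]$ and $\mathbf z_A=[\psi,0,r]$. The defender moves towards a point of the perimeter along the great-circle geodesic; the intruder's behavior is any motion with speed at most $\nu$. The play is considered until it ends (the intruder reaches the perimeter, or the defender reaches the ground with $\phi_D=\psi=0$). Payoff and optimal breaching point. A breaching point is $\mathbf z_B=[\theta,0,1]$ on the perimeter, with breaching angle $\theta$ (relative to the defender's azimuth). The payoff is $$p(\mathbf z_D,\mathbf z_A,\mathbf z_B)=\cos^{-1}(\cos\phi_D\cos\theta)-\frac1\nu\sqrt{r^2+1-2r\cos(\theta-\psi)},$$ i.e. the defender's geodesic travel time to $\mathbf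 z_B$ minus the intruder's straight-line travel time to $\mathbf z_B$. The approach angle $\beta\in[0,\pi]$ is the angle at $\mathbf z_B$ between $\mathbf z_A-\mathbf z_B$ and the tangent to the unit circle (directed toward decreasing azimuth). The optimal breaching angle $\theta^*$ and optimal approach angle $\beta^*$ for $(\mathbf z_D,\mathbf z_A)$ are those satisfying $$\beta^*=\cos^{-1}\left(\nu\frac{\cos\phi_D\sin\theta^*}{\sqrt{1-\cos^2\phi_D\cos^2\theta^*}}\right),\qquad \theta^*=\psi-\beta^*+\cos^{-1}\left(\frac{\cos\beta^*}{r}\right)$$ (angles modulo $2\pi$), and the optimal breaching point is $\mathbf z_B=[\theta^*,0,1]$. By convention of the paper this pair is unique for given $(\mathbf z_D,\mathbf z_A)$. *)

theory Defs
  imports "HOL-Analysis.Analysis" "HOL-Library.Real_Mod"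
begin

text \<open>The point with spherical coordinates [azimuth, elevation, radius].\<close>

definition sph :: "real \<Rightarrow> real \<Rightarrow> real \<Rightarrow> real^3" where
  "sph az el \<rho> = vector [\<rho> * cos el * cos az, \<rho> * cos el * sin az, \<rho> * sin el]"

text \<open>
  Below, \<open>\<phi>\<close> is the defender's elevation, \<open>\<psi>\<close> the intruder's azimuth and \<open>\<theta>\<close> the breaching
  angle, both azimuths measured relative to the defender's azimuth; \<open>r\<close> is the intruder's radius.
\<close>

definition payoff :: "real \<Rightarrow> real \<Rightarrow> real \<Rightarrow> real \<Rightarrow> real \<Rightarrow> real" where
  "payoff \<nu> \<phi> \<psi> r \<theta> =
     arccos (cos \<phi> * cos \<theta>) - (1 / \<nu>) * sqrt (r\<^sup>2 + 1 - 2 * r * cos (\<theta> - \<psi>))"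

definition optimal_pair :: "real \<Rightarrow> real \<Rightarrow> real \<Rightarrow> real \<Rightarrow> real \<Rightarrow> real \<Rightarrow> bool" where
  "optimal_pair \<nu> \<phi> \<psi> r \<theta> \<beta> \<longleftrightarrow>
     \<beta> = arccos (\<nu> * (cos \<phi> * sin \<theta> / sqrt (1 - (cos \<phi>)\<^sup>2 * (cos \<theta>)\<^sup>2))) \<and>
     [\<theta> = \<psi> - \<beta> + arccos (cos \<beta> / r)] (rmod (2 * pi))"

definition unique_optimal_pair :: "real \<Rightarrow> real \<Rightarrow> real \<Rightarrow> real \<Rightarrow> real \<Rightarrow> real \<Rightarrow> bool" where
  "unique_optimal_pair \<nu> \<phi> \<psi> r \<theta> \<beta> \<longleftrightarrow>
     optimal_pair \<nu> \<phi> \<psi> r \<theta> \<beta> \<and>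
     (\<forall>\<theta>' \<beta>'. optimal_pair \<nu> \<phi> \<psi> r \<theta>' \<beta>' \<longrightarrow> [\<theta>' = \<theta>] (rmod (2 * pi)) \<and> \<beta>' = \<beta>)"

text \<open>
  The play has ended once the intruder is at the perimeter, or the defender is on the ground at
  the intruder's azimuth.
\<close>

definition play_ended :: "real \<Rightarrow> real \<Rightarrow> real \<Rightarrow> bool" where
  "play_ended \<phi> \<psi> r \<longleftrightarrow> r \<le> 1 \<or> (\<phi> = 0 \<and> [\<psi> = 0] (rmod (2 * pi)))"

text \<open>
  First-order dynamics with velocity control \<open>u\<close> on \<open>[0,T)\<close>, in integrated form, so that
  discontinuous controls are allowed.
\<close>

definition first_order_motion :: "real \<Rightarrow> (real \<Rightarrow> real^3) \<Rightarrow> (real \<Rightarrow> real^3) \<Rightarrow> bool" where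
  "first_order_motion T z u \<longleftrightarrow> (\<forall>t\<in>{0..<T}. (u has_integral (z t - z 0)) {0..t})"

text \<open>
  The vector \<open>v\<close> is the initial velocity of a unit-speed minimal geodesic of the unit sphere from
  \<open>x\<close> to \<open>y\<close>; that geodesic is \<open>s \<mapsto> cos s *\<^sub>R x + sin s *\<^sub>R v\<close>. It is stated as a predicate because
  \<open>v\<close> is determined by \<open>x\<close> and \<open>y\<close> only if these are neither equal nor antipodal.
\<close>

definition geodesic_direction :: "real^3 \<Rightarrow> real^3 \<Rightarrow> real^3 \<Rightarrow> bool" where
  "geodesic_direction x y v \<longleftrightarrow>
     norm v = 1 \<and> x \<bullet> v = 0 \<and>
     y = cos (arccos (x \<bullet> y)) *\<^sub>R x + sin (arccos (x \<bullet> y)) *\<^sub>R v"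

end

theory Submission
  imports Defs
begin

text \<open>
  On the arc of the perimeter visible from the intruder, the optimal breaching angle is the only
  critical point of the payoff, and the payoff increases at the left end of the arc and decreases at
  the right end; so the optimal point is the strict maximizer on that arc. Hence, as for any value
  function of a maximization problem, an increment of the payoff over \<open>[s, t]\<close> is at most the
  increment with the breaching point frozen at its value at time \<open>t\<close>. With this point frozen, the
  defender's travel time has left derivative \<open>-1\<close> at \<open>t\<close>, since the defender heads for it, and the
  intruder's travel time drops at most at rate \<open>1\<close>. So the left upper Dini derivative of the payoff
  is nowhere positive. It remains to see that the defender never reaches the ground, where
  the maximization argument would break down.
\<close>

section \<open>Slopes of the two travel times\<close>

text \<open>The derivative of \<open>arccos (cos \<phi> * cos x)\<close> in \<open>x\<close>, that
  is, the cosine of the angle between the defender's geodesic and the perimeter. In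
  \<open>optimal_pair\<close>, \<nu> times this number is the argument of the \<open>arccos\<close>
  that gives \<beta>.\<close>

definition defender_slope :: "real \<Rightarrow> real \<Rightarrow> real" where
  "defender_slope \<phi> x = cos \<phi> * sin x / sqrt (1 - (cos \<phi>)\<^sup>2 * (cos x)\<^sup>2)"

definition intruder_dist :: "real \<Rightarrow> real \<Rightarrow> real \<Rightarrow> real" where
  "intruder_dist \<psi> r x = sqrt (r\<^sup>2 + 1 - 2 * r * cos (x - \<psi>))"

definition payoff_slope :: "real \<Rightarrow> real \<Rightarrow> real \<Rightarrow> real \<Rightarrow> real \<Rightarrow> real" where
  "payoff_slope \<nu> \<phi> \<psi> r x =
     defender_slope \<phi> x - r * sin (x - \<psi>) / (\<nu> * intruder_dist \<psi> r x)"

lemma rcong_2pi_iff: "[x = y] (rmod (2 * pi)) \<longleftrightarrow> cos x = cos y \<and> sin x = sin y"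
  by (metis cis.sel cis_eq_iff complex_eq_iff)

lemma cos_elevation_less_1:
  assumes "0 < \<phi>" "\<phi> \<le> pi / 2"
  shows "0 \<le> cos \<phi>" "cos \<phi> < 1"
  using assms cos_monotone_0_pi[of 0 \<phi>] by (auto intro: cos_ge_zero)

lemma abs_cos_mult_less_1:
  assumes "0 < \<phi>" "\<phi> \<le> pi / 2"
  shows "\<bar>cos \<phi> * cos x\<bar> < 1"
proof -
  have "\<bar>cos \<phi>\<bar> * \<bar>cos x\<bar> \<le> \<bar>cos \<phi>\<bar> * 1"
    by (intro mult_left_mono) auto
  then show ?thesis
    using cos_elevation_less_1[OF assms] by (simp add: abs_mult)
qed

lemma slope_radicand_pos:
  assumes "0 < \<phi>" "\<phi> \<le> pi / 2"
  shows "0 < 1 - (cos \<phi>)\<^sup>2 * (cos x)\<^sup>2"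
  using abs_cos_mult_less_1[OF assms, of x]
  by (metis abs_square_less_1 diff_gt_0_iff_gt power_mult_distrib)

text \<open>Since \<open>(cos \<phi>)\<^sup>2 \<le> 1\<close>, the radicand is at least
  \<open>(sin x)\<^sup>2\<close>. The bound \<open>cos \<phi>\<close>, which is less than 1, later
  yields strict signs at the ends of the visible arc and the visibility margin
  \<open>(r - 1) * sin \<phi>\<close>.\<close>

lemma defender_slope_bound:
  assumes "0 < \<phi>" "\<phi> \<le> pi / 2"
  shows "\<bar>defender_slope \<phi> x\<bar> \<le> cos \<phi>"
proof (rule power2_le_imp_le)
  have "(cos \<phi>)\<^sup>2 * (cos x)\<^sup>2 \<le> 1 * (cos x)\<^sup>2"
    by (intro mult_right_mono) (auto simp: abs_square_le_1)
  then have "(sin x)\<^sup>2 \<le> 1 - (cos \<phi>)\<^sup>2 * (cos x)\<^sup>2"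
    by (simp add: sin_squared_eq)
  then have "(cos \<phi>)\<^sup>2 * (sin x)\<^sup>2 \<le> (cos \<phi>)\<^sup>2 * (1 - (cos \<phi>)\<^sup>2 * (cos x)\<^sup>2)"
    by (rule mult_left_mono) simp
  then show "\<bar>defender_slope \<phi> x\<bar>\<^sup>2 \<le> (cos \<phi>)\<^sup>2"
    using slope_radicand_pos[OF assms, of x]
    by (simp add: defender_slope_def power_divide power_mult_distrib divide_le_eq)
  show "0 \<le> cos \<phi>"
    using cos_elevation_less_1[OF assms] by simp
qed

lemma intruder_dist_ge:
  assumes "1 < r"
  shows "r - 1 \<le> intruder_dist \<psi> r x" "0 < intruder_dist \<psi> r x"
proof -
  have "r * cos (x - \<psi>) \<le> r * 1"
    using assms by (intro mult_left_mono) auto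
  then have "(r - 1)\<^sup>2 \<le> r\<^sup>2 + 1 - 2 * r * cos (x - \<psi>)"
    by (simp add: power2_eq_square algebra_simps)
  then show "r - 1 \<le> intruder_dist \<psi> r x"
    unfolding intruder_dist_def by (rule real_le_rsqrt)
  then show "0 < intruder_dist \<psi> r x"
    using assms by simp
qed

lemma intruder_dist_sq:
  assumes "1 < r"
  shows "(intruder_dist \<psi> r x)\<^sup>2 = r\<^sup>2 + 1 - 2 * r * cos (x - \<psi>)"
  using intruder_dist_ge[OF assms, of \<psi> x]
  by (auto simp: intruder_dist_def intro!: real_sqrt_pow2)

section \<open>Optimal pairs and critical points of the payoff\<close>

text \<open>
  The two defining equations say that \<open>\<theta>\<close> is a critical point of the payoff and that the segment
  from the intruder to the breaching point does not enter the disc.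
\<close>

lemma optimal_pair_critical:
  assumes "0 < \<nu>" "\<nu> \<le> 1" "0 < \<phi>" "\<phi> \<le> pi / 2" "1 < r"
    and "optimal_pair \<nu> \<phi> \<psi> r \<theta> \<beta>"
  shows "payoff_slope \<nu> \<phi> \<psi> r \<theta> = 0"
    and "1 + (r - 1) * sin \<phi> \<le> r * cos (\<theta> - \<psi>)"
proof -
  define \<alpha> where "\<alpha> = arccos (cos \<beta> / r)"
  have \<nu>f: "\<bar>\<nu> * defender_slope \<phi> \<theta>\<bar> \<le> cos \<phi>"
    using mult_mono[OF assms(2) defender_slope_bound[OF assms(3,4), of \<theta>]] assms(1)
    by (simp add: abs_mult)
  then have \<nu>f1: "\<bar>\<nu> * defender_slope \<phi> \<theta>\<bar> \<le> 1"
    using cos_le_one order_trans by blast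
  have \<beta>: "\<beta> = arccos (\<nu> * defender_slope \<phi> \<theta>)" and
    cong: "[\<theta> = \<psi> - \<beta> + \<alpha>] (rmod (2 * pi))"
    using assms(6) by (auto simp: optimal_pair_def defender_slope_def \<alpha>_def)
  have cos\<beta>: "cos \<beta> = \<nu> * defender_slope \<phi> \<theta>"
    unfolding \<beta> using \<nu>f1 by (intro cos_arccos_abs)
  have sin\<beta>0: "0 \<le> sin \<beta>"
    unfolding \<beta> using \<nu>f1 by (intro sin_ge_zero arccos_lbound arccos_ubound) auto
  have sin\<beta>: "sin \<phi> \<le> sin \<beta>"
  proof (rule power2_le_imp_le)
    have "(cos \<beta>)\<^sup>2 \<le> (cos \<phi>)\<^sup>2"
      using \<nu>f unfolding cos\<beta> by (rule abs_le_square_iff[THEN iffD1, OF order_trans]) simp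
    then show "(sin \<phi>)\<^sup>2 \<le> (sin \<beta>)\<^sup>2"
      by (simp add: sin_squared_eq)
  qed (fact sin\<beta>0)
  have "\<bar>cos \<beta>\<bar> \<le> 1 * r"
    using assms(5) abs_cos_le_one[of \<beta>] by linarith
  then have cr: "\<bar>cos \<beta> / r\<bar> \<le> 1"
    using assms(5) by (simp add: divide_le_eq)
  have cos\<alpha>: "r * cos \<alpha> = cos \<beta>"
    using cos_arccos_abs[OF cr] assms(5) by (simp add: \<alpha>_def)
  have sin\<alpha>: "0 \<le> sin \<alpha>"
    unfolding \<alpha>_def using cr[unfolded abs_le_iff]
    by (intro sin_ge_zero arccos_lbound arccos_ubound) linarith+
  \<comment> \<open>The line through the intruder and the breaching point has distance
    \<open>\<bar>cos \<beta>\<bar>\<close> from the origin. Measured along it from the foot of the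
    perpendicular, the breaching point lies at \<open>sin \<beta>\<close> and the intruder at
    \<open>r * sin \<alpha>\<close>, so \<open>k\<close> is the candidate for their
    distance.\<close>
  define k where "k = r * sin \<alpha> - sin \<beta>"
  have "sin (\<theta> - \<psi>) = sin (\<alpha> - \<beta>)" "cos (\<theta> - \<psi>) = cos (\<alpha> - \<beta>)"
    using rcong_diff[OF cong rcong_refl, of \<psi>] by (simp_all add: rcong_2pi_iff)
  then have sc: "sin (\<theta> - \<psi>) = sin \<alpha> * cos \<beta> - cos \<alpha> * sin \<beta>"
      "cos (\<theta> - \<psi>) = cos \<alpha> * cos \<beta> + sin \<alpha> * sin \<beta>"
    by (simp_all only: sin_diff cos_diff)
  \<comment> \<open>\<open>s\<close> and \<open>c\<close> give the tangential and radial coordinates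
    of the intruder in the frame at the breaching point: \<open>k * cos \<beta>\<close> and
    \<open>1 + k * sin \<beta>\<close>.\<close>
  have s: "r * sin (\<theta> - \<psi>) = k * cos \<beta>"
    unfolding sc k_def by (simp add: algebra_simps flip: cos\<alpha>)
  have "r * cos (\<theta> - \<psi>) = (r * cos \<alpha>) * cos \<beta> + r * sin \<alpha> * sin \<beta>"
    unfolding sc by (simp add: algebra_simps)
  then have c: "r * cos (\<theta> - \<psi>) = 1 + k * sin \<beta>"
    unfolding cos\<alpha> using sin_cos_squared_add[of \<beta>]
    by (simp add: k_def power2_eq_square algebra_simps)
  \<comment> \<open>This leads to \<open>r - 1 \<le> k\<close>. It makes \<open>k\<close>, and not
    \<open>- k\<close>, the distance, and it also supplies the factor \<open>r - 1\<close> of the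
    visibility margin.\<close>
  have "(sin \<beta> + (r - 1))\<^sup>2 \<le> (r * sin \<alpha>)\<^sup>2"
  proof -
    have "(r * sin \<alpha>)\<^sup>2 = r\<^sup>2 - (r * cos \<alpha>)\<^sup>2"
      by (simp add: power_mult_distrib sin_squared_eq algebra_simps)
    also have "\<dots> = r\<^sup>2 - 1 + (sin \<beta>)\<^sup>2"
      unfolding cos\<alpha> by (simp add: cos_squared_eq)
    finally have "(r * sin \<alpha>)\<^sup>2 - (sin \<beta> + (r - 1))\<^sup>2 = 2 * (r - 1) * (1 - sin \<beta>)"
      by (simp add: power2_eq_square algebra_simps)
    moreover have "0 \<le> 2 * (r - 1) * (1 - sin \<beta>)"
      using assms(5) by (intro mult_nonneg_nonneg) auto
    ultimately show ?thesis by linarith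
  qed
  then have "sin \<beta> + (r - 1) \<le> r * sin \<alpha>"
    by (rule power2_le_imp_le) (use sin\<alpha> assms(5) in auto)
  then have k: "r - 1 \<le> k"
    by (simp add: k_def)
  have "(intruder_dist \<psi> r \<theta>)\<^sup>2 = k\<^sup>2"
  proof -
    have "(intruder_dist \<psi> r \<theta>)\<^sup>2 = (r * sin (\<theta> - \<psi>))\<^sup>2 + (r * cos (\<theta> - \<psi>) - 1)\<^sup>2"
      unfolding intruder_dist_sq[OF assms(5)]
      by (simp add: power2_diff power_mult_distrib sin_squared_eq algebra_simps)
    also have "\<dots> = k\<^sup>2 * ((cos \<beta>)\<^sup>2 + (sin \<beta>)\<^sup>2)"
      unfolding s c by (simp only: power_mult_distrib distrib_left add_diff_cancel_left')
    finally show ?thesis by simp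
  qed
  then have dist: "intruder_dist \<psi> r \<theta> = k"
    using intruder_dist_ge(2)[OF assms(5)] k assms(5)
    by (metis diff_gt_0_iff_gt less_le_trans order_less_imp_le power2_eq_iff_nonneg)
  show "payoff_slope \<nu> \<phi> \<psi> r \<theta> = 0"
    using k assms(1,5) by (simp add: payoff_slope_def dist s cos\<beta>)
  have "(r - 1) * sin \<phi> \<le> k * sin \<beta>"
    using k sin\<beta> assms(3,4,5) by (intro mult_mono sin_ge_zero) auto
  then show "1 + (r - 1) * sin \<phi> \<le> r * cos (\<theta> - \<psi>)"
    by (simp add: c)
qed

text \<open>Criticality fixes the tangential coordinate of the intruder as
  \<open>k * cos \<beta>\<close>; the distance then fixes the radial one up to sign, and visibility
  selects the sign. Through this converse of \<open>optimal_pair_critical\<close>, uniqueness of the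
  optimal pair becomes uniqueness of the visible critical point.\<close>

lemma optimal_pair_of_critical:
  assumes "0 < \<nu>" "\<nu> \<le> 1" "0 < \<phi>" "\<phi> \<le> pi / 2" "1 < r"
    and "payoff_slope \<nu> \<phi> \<psi> r x = 0" "1 \<le> r * cos (x - \<psi>)"
  shows "optimal_pair \<nu> \<phi> \<psi> r x (arccos (\<nu> * defender_slope \<phi> x))"
proof -
  define \<beta> where "\<beta> = arccos (\<nu> * defender_slope \<phi> x)"
  define k where "k = intruder_dist \<psi> r x"
  \<comment> \<open>The candidate for \<open>arccos (cos \<beta> / r)\<close>: below it turns out to
    have the right cosine and a nonnegative sine, which determines it modulo 2 pi.\<close>
  define \<gamma> where "\<gamma> = x - \<psi> + \<beta>"
  have k: "0 < k"
    unfolding k_def by (rule intruder_dist_ge(2)[OF assms(5)])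
  have "\<bar>\<nu> * defender_slope \<phi> x\<bar> \<le> cos \<phi>"
    using mult_mono[OF assms(2) defender_slope_bound[OF assms(3,4), of x]] assms(1)
    by (simp add: abs_mult)
  then have \<nu>f1: "\<bar>\<nu> * defender_slope \<phi> x\<bar> \<le> 1"
    using cos_le_one order_trans by blast
  have cos\<beta>: "cos \<beta> = \<nu> * defender_slope \<phi> x"
    unfolding \<beta>_def using \<nu>f1 by (intro cos_arccos_abs)
  have sin\<beta>0: "0 \<le> sin \<beta>"
    unfolding \<beta>_def using \<nu>f1 by (intro sin_ge_zero arccos_lbound arccos_ubound) auto
  have s: "k * cos \<beta> = r * sin (x - \<psi>)"
    using assms(1,6) k by (simp add: cos\<beta> payoff_slope_def field_simps flip: k_def)
  have "(k * sin \<beta>)\<^sup>2 = k\<^sup>2 - (k * cos \<beta>)\<^sup>2"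
    by (simp add: power_mult_distrib sin_squared_eq algebra_simps)
  also have "\<dots> = (r * cos (x - \<psi>) - 1)\<^sup>2"
    unfolding s unfolding k_def intruder_dist_sq[OF assms(5)]
    by (simp add: power2_diff power_mult_distrib sin_squared_eq algebra_simps)
  finally have c: "k * sin \<beta> = r * cos (x - \<psi>) - 1"
    using assms(7) k sin\<beta>0 by (subst (asm) power2_eq_iff_nonneg) auto
  have "k * cos \<gamma> = cos (x - \<psi>) * (k * cos \<beta>) - sin (x - \<psi>) * (k * sin \<beta>)"
    unfolding \<gamma>_def cos_add by (simp add: algebra_simps)
  also have "\<dots> = sin (x - \<psi>)"
    unfolding s c by (simp add: algebra_simps)
  also have "\<dots> = k * (cos \<beta> / r)"
    using s assms(5) by (simp add: field_simps)
  finally have cos\<gamma>: "cos \<gamma> = cos \<beta> / r"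
    using k by (simp only: mult_cancel_left) simp
  have "k * sin \<gamma> = sin (x - \<psi>) * (k * cos \<beta>) + cos (x - \<psi>) * (k * sin \<beta>)"
    unfolding \<gamma>_def sin_add by (simp add: algebra_simps)
  also have "\<dots> = r * ((sin (x - \<psi>))\<^sup>2 + (cos (x - \<psi>))\<^sup>2) - cos (x - \<psi>)"
    unfolding s c by (simp only: power2_eq_square) algebra
  also have "\<dots> = r - cos (x - \<psi>)"
    by simp
  also have "\<dots> \<ge> 0"
    using assms(5) cos_le_one[of "x - \<psi>"] by linarith
  finally have sin\<gamma>: "0 \<le> sin \<gamma>"
    using k by (simp add: zero_le_mult_iff)
  have "cos (arccos (cos \<gamma>)) = cos \<gamma>"
    by simp
  moreover have "sin (arccos (cos \<gamma>)) = sin \<gamma>"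
    using sin\<gamma> by (simp add: sin_arccos_abs flip: sin_squared_eq)
  ultimately have "[\<gamma> = arccos (cos \<gamma>)] (rmod (2 * pi))"
    by (simp add: rcong_2pi_iff)
  then have "[\<psi> - \<beta> + \<gamma> = \<psi> - \<beta> + arccos (cos \<beta> / r)] (rmod (2 * pi))"
    unfolding cos\<gamma> by (intro rcong_add rcong_refl)
  then show ?thesis
    by (simp add: optimal_pair_def \<gamma>_def flip: \<beta>_def) (simp add: \<beta>_def defender_slope_def)
qed

section \<open>The maximum on the visible arc\<close>

text \<open>Visibility depends only on \<open>cos y\<close>. Taking \<open>arccos (cos y)\<close>
  with the sign of \<open>sin y\<close> turns the arc into an interval, where intermediate values
  and monotonicity are available.\<close>

lemma visible_representative:
  fixes y :: real
  assumes "1 < r" "1 \<le> r * cos y"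
  obtains y' where "\<bar>y'\<bar> \<le> arccos (1 / r)" "cos y' = cos y" "sin y' = sin y"
proof
  define y' where "y' = (if sin y \<ge> 0 then arccos (cos y) else - arccos (cos y))"
  have "1 / r \<le> cos y"
    using assms by (simp add: field_simps)
  moreover have "-1 \<le> 1 / r"
    using assms by (smt (verit) divide_nonneg_pos)
  ultimately have "arccos (cos y) \<le> arccos (1 / r)"
    by (intro arccos_le_arccos) auto
  then show "\<bar>y'\<bar> \<le> arccos (1 / r)"
    by (simp add: y'_def arccos_lbound)
  show "cos y' = cos y"
    by (simp add: y'_def)
  show "sin y' = sin y"
    by (simp add: y'_def sin_arccos_abs flip: sin_squared_eq)
qed

lemma payoff_has_derivative:
  assumes "0 < \<nu>" "0 < \<phi>" "\<phi> \<le> pi / 2" "1 < r"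
  shows "(payoff \<nu> \<phi> \<psi> r has_real_derivative payoff_slope \<nu> \<phi> \<psi> r x) (at x)"
proof -
  have c: "-1 < cos \<phi> * cos x" "cos \<phi> * cos x < 1"
    using abs_cos_mult_less_1[OF assms(2,3), of x] by auto
  have d: "0 < r\<^sup>2 + 1 - 2 * r * cos (x - \<psi>)"
    using intruder_dist_ge(2)[OF assms(4), of \<psi> x] by (simp add: intruder_dist_def)
  show ?thesis
    unfolding payoff_def [abs_def] payoff_slope_def defender_slope_def intruder_dist_def
    using slope_radicand_pos[OF assms(2,3), of x] d assms(1)
    by (auto intro!: derivative_eq_intros DERIV_arccos c
        simp: power_mult_distrib field_simps)
qed

text \<open>At the ends of the arc the line of sight is tangent to the circle, so the intruder's
  travel time has slope of size \<open>1 / \<nu> \<ge> 1\<close>, which dominates the defender's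
  slope. By uniqueness the payoff slope has no zero on the arc except at \<theta>, so it is positive
  before \<theta> and negative after it.\<close>

lemma visible_arc_optimum:
  assumes \<nu>: "0 < \<nu>" "\<nu> \<le> 1" and \<phi>: "0 < \<phi>" "\<phi> \<le> pi / 2" and r: "1 < r"
    and opt: "unique_optimal_pair \<nu> \<phi> \<psi> r \<theta> \<beta>"
    and vis: "1 \<le> r * cos (x - \<psi>)"
  shows "payoff \<nu> \<phi> \<psi> r x < payoff \<nu> \<phi> \<psi> r \<theta> \<or> [x = \<theta>] (rmod (2 * pi))"
proof -
  define a where "a = arccos (1 / r)"
  define F where "F = payoff_slope \<nu> \<phi> \<psi> r"
  have r1: "\<bar>1 / r\<bar> \<le> 1"
    using r by simp
  have cosa: "cos a = 1 / r"
    unfolding a_def by (rule cos_arccos_abs[OF r1])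
  have a: "0 < a" "a < pi / 2"
    unfolding a_def
    using r r1[unfolded abs_le_iff] arccos_less_arccos[of "1 / r" 1] arccos_less_arccos[of 0 "1 / r"]
    by auto
  have visible: "1 \<le> r * cos (y - \<psi>)" if "\<bar>y - \<psi>\<bar> \<le> a" for y
  proof -
    have "cos a \<le> cos \<bar>y - \<psi>\<bar>"
      using that a by (intro cos_monotone_0_pi_le) auto
    then show ?thesis
      using r by (simp add: cosa field_simps)
  qed
  have shift: "payoff \<nu> \<phi> \<psi> r y = payoff \<nu> \<phi> \<psi> r z" "F y = F z"
    if "[y = z] (rmod (2 * pi))" for y z
    using that rcong_diff[OF that rcong_refl, of \<psi>]
    by (simp_all add: F_def payoff_def payoff_slope_def defender_slope_def intruder_dist_def
        rcong_2pi_iff)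
  have repr: "\<exists>y'. \<bar>y' - \<psi>\<bar> \<le> a \<and> [y' = y] (rmod (2 * pi))" if y: "1 \<le> r * cos (y - \<psi>)" for y
  proof -
    obtain z where z: "\<bar>z\<bar> \<le> a" "cos z = cos (y - \<psi>)" "sin z = sin (y - \<psi>)"
      using visible_representative[OF r y] unfolding a_def by metis
    then have "[\<psi> + z = \<psi> + (y - \<psi>)] (rmod (2 * pi))"
      by (intro rcong_add rcong_refl) (simp add: rcong_2pi_iff)
    then show ?thesis
      using z(1) by (intro exI[of _ "\<psi> + z"]) auto
  qed
  have \<theta>: "optimal_pair \<nu> \<phi> \<psi> r \<theta> \<beta>"
    using opt by (simp add: unique_optimal_pair_def)
  have "0 \<le> (r - 1) * sin \<phi>"
    using r \<phi> by (intro mult_nonneg_nonneg sin_ge_zero) auto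
  then have "1 \<le> r * cos (\<theta> - \<psi>)"
    using optimal_pair_critical(2)[OF \<nu> \<phi> r \<theta>] by linarith
  then obtain \<theta>' where \<theta>': "\<bar>\<theta>' - \<psi>\<bar> \<le> a" "[\<theta>' = \<theta>] (rmod (2 * pi))"
    using repr by blast
  obtain x' where x': "\<bar>x' - \<psi>\<bar> \<le> a" "[x' = x] (rmod (2 * pi))"
    using repr vis by blast
  have zero: "y = \<theta>'" if "F y = 0" "\<bar>y - \<psi>\<bar> \<le> a" for y
  proof -
    have "optimal_pair \<nu> \<phi> \<psi> r y (arccos (\<nu> * defender_slope \<phi> y))"
      using that visible by (intro optimal_pair_of_critical \<nu> \<phi> r) (auto simp: F_def)
    then have "[y = \<theta>] (rmod (2 * pi))"
      using opt by (auto simp: unique_optimal_pair_def)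
    then have *: "[y = \<theta>'] (rmod (2 * pi))"
      using \<theta>'(2) rcong_sym rcong_trans by blast
    \<comment> \<open>Two angles of the arc differ by at most \<open>2 * a\<close>, which is less
      than pi, so congruence forces equality.\<close>
    show ?thesis
      by (rule rcong_imp_eq[OF *]) (use that(2) \<theta>'(1) a in linarith)
  qed
  have f1: "\<bar>defender_slope \<phi> y\<bar> < 1" for y
    using defender_slope_bound[OF \<phi>, of y] cos_elevation_less_1[OF \<phi>] by linarith
  have dist_a: "intruder_dist \<psi> r (\<psi> + a) = r * sin a" "intruder_dist \<psi> r (\<psi> - a) = r * sin a"
    and sina: "0 < sin a"
  proof -
    show "0 < sin a"
      using a by (intro sin_gt_zero) auto
    \<comment> \<open>\<open>sqrt (r\<^sup>2 - 1)\<close> is the length of the tangent segment from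
      the intruder to the circle.\<close>
    then have "sqrt (r\<^sup>2 - 1) = r * sin a"
      using r by (intro real_sqrt_unique)
        (auto simp: power_mult_distrib sin_squared_eq cosa field_simps)
    then show "intruder_dist \<psi> r (\<psi> + a) = r * sin a" "intruder_dist \<psi> r (\<psi> - a) = r * sin a"
      using r by (auto simp: intruder_dist_def cosa)
  qed
  have "1 \<le> 1 / \<nu>"
    using \<nu> by simp
  moreover have "F (\<psi> - a) = defender_slope \<phi> (\<psi> - a) + 1 / \<nu>"
    "F (\<psi> + a) = defender_slope \<phi> (\<psi> + a) - 1 / \<nu>"
    using sina r by (simp_all add: F_def payoff_slope_def dist_a)
  ultimately have ends: "F (\<psi> - a) > 0" "F (\<psi> + a) < 0"
    using f1[of "\<psi> - a"] f1[of "\<psi> + a"] by linarith+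
  have cont: "continuous_on A F" for A
    unfolding F_def payoff_slope_def [abs_def] defender_slope_def intruder_dist_def
    using slope_radicand_pos[OF \<phi>] intruder_dist_ge(2)[OF r, of \<psi>] \<nu>(1)
    by (intro continuous_intros) (auto simp: intruder_dist_def less_imp_neq[symmetric])
  have left: "0 < F y" if "\<bar>y - \<psi>\<bar> \<le> a" "y < \<theta>'" for y
  proof (rule ccontr)
    assume "\<not> 0 < F y"
    then have "F y \<le> 0" "0 \<le> F (\<psi> - a)" "\<psi> - a \<le> y"
      using ends that(1) by linarith+
    then obtain z where "\<psi> - a \<le> z" "z \<le> y" "F z = 0"
      using IVT2'[OF _ _ _ cont] by blast
    then show False
      using zero[of z] that by (simp add: abs_le_iff)
  qed
  have right: "F y < 0" if "\<bar>y - \<psi>\<bar> \<le> a" "\<theta>' < y" for y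
  proof (rule ccontr)
    assume "\<not> F y < 0"
    then have "F (\<psi> + a) \<le> 0" "0 \<le> F y" "y \<le> \<psi> + a"
      using ends that(1) by linarith+
    then obtain z where "y \<le> z" "z \<le> \<psi> + a" "F z = 0"
      using IVT2'[OF _ _ _ cont] by blast
    then show False
      using zero[of z] that by (simp add: abs_le_iff)
  qed
  have DERIV: "(payoff \<nu> \<phi> \<psi> r has_real_derivative F y) (at y)" for y
    unfolding F_def by (rule payoff_has_derivative[OF \<nu>(1) \<phi> r])
  then have pcont: "continuous_on A (payoff \<nu> \<phi> \<psi> r)" for A
    by (meson DERIV_continuous_on has_field_derivative_at_within)
  consider "x' = \<theta>'" | "x' < \<theta>'" | "\<theta>' < x'"
    by linarith
  then show ?thesis
  proof cases
    case 1
    then show ?thesis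
      using x'(2) \<theta>'(2) rcong_sym rcong_trans by blast
  next
    case 2
    have "payoff \<nu> \<phi> \<psi> r x' < payoff \<nu> \<phi> \<psi> r \<theta>'"
    proof (rule DERIV_pos_imp_increasing_open[OF 2 _ pcont])
      fix y assume y: "x' < y" "y < \<theta>'"
      have "\<bar>y - \<psi>\<bar> \<le> a"
        using x'(1) \<theta>'(1) y by linarith
      then show "\<exists>d. (payoff \<nu> \<phi> \<psi> r has_real_derivative d) (at y) \<and> 0 < d"
        using left y(2) DERIV by blast
    qed
    then show ?thesis
      using shift(1)[OF x'(2)] shift(1)[OF \<theta>'(2)] by simp
  next
    case 3
    have "payoff \<nu> \<phi> \<psi> r x' < payoff \<nu> \<phi> \<psi> r \<theta>'"
    proof (rule DERIV_neg_imp_decreasing_open[OF 3 _ pcont])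
      fix y assume y: "\<theta>' < y" "y < x'"
      have "\<bar>y - \<psi>\<bar> \<le> a"
        using x'(1) \<theta>'(1) y by linarith
      then show "\<exists>d. (payoff \<nu> \<phi> \<psi> r has_real_derivative d) (at y) \<and> d < 0"
        using right y(1) DERIV by blast
    qed
    then show ?thesis
      using shift(1)[OF x'(2)] shift(1)[OF \<theta>'(2)] by simp
  qed
qed

section \<open>A Dini criterion for monotonicity\<close>

text \<open>Induction from \<open>b\<close> downwards: the set \<open>S\<close> of times from which
  \<open>V\<close> grows at rate at most \<epsilon> up to \<open>b\<close> is closed, and the Dini
  condition at its infimum produces an earlier member unless the infimum is
  \<open>a\<close>.\<close>

lemma left_Dini_nonpos_imp_le:
  fixes V :: "real \<Rightarrow> real"
  assumes "a \<le> b" and cont: "continuous_on {a..b} V"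
    and Dini: "\<And>t \<epsilon>. a < t \<Longrightarrow> t \<le> b \<Longrightarrow> 0 < \<epsilon> \<Longrightarrow> \<exists>s\<in>{a..<t}. V t - V s \<le> \<epsilon> * (t - s)"
  shows "V b \<le> V a"
proof (rule field_le_epsilon)
  fix e :: real assume "0 < e"
  \<comment> \<open>The summand 1 keeps the denominator positive when \<open>a = b\<close>.\<close>
  define \<epsilon> where "\<epsilon> = e / (b - a + 1)"
  have \<epsilon>: "0 < \<epsilon>" "\<epsilon> * (b - a) \<le> e"
    using \<open>0 < e\<close> \<open>a \<le> b\<close> by (auto simp: \<epsilon>_def field_simps)
  define S where "S = {t \<in> {a..b}. V b - V t \<le> \<epsilon> * (b - t)}"
  have "closed S"
    unfolding S_def
    by (intro continuous_on_closed_Collect_le continuous_intros cont)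
  moreover have "b \<in> S" "bdd_below S"
    using \<open>a \<le> b\<close> by (auto simp: S_def intro: bdd_belowI[of _ a])
  ultimately have c: "Inf S \<in> S"
    using closed_contains_Inf by blast
  have "Inf S = a"
  proof (rule ccontr)
    assume "Inf S \<noteq> a"
    then obtain s where s: "s \<in> {a..<Inf S}" "V (Inf S) - V s \<le> \<epsilon> * (Inf S - s)"
      using Dini[of "Inf S" \<epsilon>] c \<epsilon>(1) by (auto simp: S_def)
    then have "s \<in> S"
      using c by (auto simp: S_def algebra_simps)
    then have "Inf S \<le> s"
      using \<open>bdd_below S\<close> by (rule cInf_lower)
    then show False using s(1) by simp
  qed
  then show "V b \<le> V a + e"
    using c \<epsilon>(2) by (auto simp: S_def)
qed

section \<open>First-order motion\<close>

lemma first_order_motion_has_integral: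
  assumes "first_order_motion T z u" "0 \<le> s" "s \<le> t" "t < T"
  shows "(u has_integral (z t - z s)) {s..t}"
proof -
  have s: "(u has_integral (z s - z 0)) {0..s}" and t: "(u has_integral (z t - z 0)) {0..t}"
    using assms by (auto simp: first_order_motion_def)
  have "u integrable_on {s..t}"
    by (rule integrable_subinterval_real[OF has_integral_integrable[OF t]]) (use assms in auto)
  then obtain I where I: "(u has_integral I) {s..t}"
    by blast
  have "z s - z 0 + I = z t - z 0"
    using has_integral_combine[OF assms(2,3) s I] t by (rule has_integral_unique)
  then have "I = z t - z s"
    by (simp add: algebra_simps)
  then show ?thesis using I by simp
qed

lemma first_order_motion_lipschitz:
  assumes "first_order_motion T z u" and "\<And>t. t \<in> {0..<T} \<Longrightarrow> norm (u t) \<le> K" and "0 \<le> K"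
    and "s \<in> {0..<T}" "t \<in> {0..<T}"
  shows "norm (z t - z s) \<le> K * \<bar>t - s\<bar>"
proof -
  have *: "norm (z t - z s) \<le> K * (t - s)" if "s \<in> {0..<T}" "t \<in> {0..<T}" "s \<le> t" for s t
    using has_integral_bound[of K u "z t - z s" s t] that assms(2,3)
      first_order_motion_has_integral[OF assms(1), of s t]
    by auto
  show ?thesis
    using *[of s t] *[of t s] assms(4,5) by (cases "s \<le> t") (auto simp: norm_minus_commute)
qed

lemma first_order_motion_continuous:
  assumes "first_order_motion T z u" and "\<And>t. t \<in> {0..<T} \<Longrightarrow> norm (u t) \<le> K" and "0 \<le> K"
  shows "continuous_on {0..<T} z"
proof (rule lipschitz_on_continuous_on)
  show "K-lipschitz_on {0..<T} z"
    using first_order_motion_lipschitz[OF assms] assms(3)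
    by (auto intro!: lipschitz_onI simp: dist_norm norm_minus_commute abs_minus_commute)
qed

section \<open>Coordinate-free form of the payoff\<close>

definition perimeter :: "(real^3) set" where
  "perimeter = {b. norm b = 1 \<and> b $ 3 = 0}"

text \<open>The payoff in terms of positions instead of angles; \<open>payoff_vec_sph\<close> is the
  link to \<open>payoff\<close>.\<close>

definition payoff_vec :: "real \<Rightarrow> real^3 \<Rightarrow> real^3 \<Rightarrow> real^3 \<Rightarrow> real" where
  "payoff_vec \<nu> x a b = arccos (x \<bullet> b) - norm (a - b) / \<nu>"

lemma compact_perimeter: "compact perimeter"
proof -
  have "perimeter = sphere 0 1 \<inter> {b. b $ 3 = 0}"
    by (auto simp: perimeter_def)
  moreover have "closed {b :: real^3. b $ 3 = 0}"
    by (intro closed_Collect_eq continuous_intros)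
  ultimately show ?thesis
    by (metis compact_Int_closed compact_sphere)
qed

lemma abs_inner_perimeter_le_1:
  assumes "norm x = 1" "b \<in> perimeter"
  shows "\<bar>x \<bullet> b\<bar> \<le> 1"
  using Cauchy_Schwarz_ineq2[of x b] assms by (simp add: perimeter_def)

text \<open>Equality in Cauchy-Schwarz would put \<open>x\<close> at \<open>b\<close> or
  \<open>- b\<close>, hence on the ground. Strictness makes the geodesic direction unique and
  \<open>arccos\<close> differentiable.\<close>

lemma abs_inner_perimeter_less_1:
  assumes x: "norm x = 1" "x $ 3 \<noteq> 0" and b: "b \<in> perimeter"
  shows "\<bar>x \<bullet> b\<bar> < 1"
proof -
  have "\<bar>x \<bullet> b\<bar> \<noteq> 1"
  proof
    assume "\<bar>x \<bullet> b\<bar> = 1"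
    then have "x = b \<or> x = - b"
      using norm_cauchy_schwarz_abs_eq[of x b] x b by (auto simp: perimeter_def)
    then show False
      using x b by (auto simp: perimeter_def)
  qed
  then show ?thesis
    using abs_inner_perimeter_le_1[OF x(1) b] by linarith
qed

section \<open>Pursuit of a strictly optimal perimeter point\<close>

text \<open>
  Only the unit vector \<open>B t\<close> enters here, which avoids the azimuth of the defender; the latter is
  arbitrary, hence possibly discontinuous, while the defender is at the pole.
\<close>

locale pursuit =
  fixes \<nu> T :: real and D A B u w :: "real \<Rightarrow> real^3"
  assumes \<nu>: "0 < \<nu>"
    and D_motion: "first_order_motion T D u" and A_motion: "first_order_motion T A w"
    and D_unit: "t \<in> {0..<T} \<Longrightarrow> norm (D t) = 1"
    and D_nonneg: "t \<in> {0..<T} \<Longrightarrow> 0 \<le> D t $ 3"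
    and D_start: "0 < D 0 $ 3"
    and A_outside: "t \<in> {0..<T} \<Longrightarrow> 1 < norm (A t)"
    and A_ground: "t \<in> {0..<T} \<Longrightarrow> A t $ 3 = 0"
    and apart: "t \<in> {0..<T} \<Longrightarrow> norm (A t) *\<^sub>R D t \<noteq> A t"
    and B_perimeter: "t \<in> {0..<T} \<Longrightarrow> B t \<in> perimeter"
    and B_visible: "t \<in> {0..<T} \<Longrightarrow> 0 < D t $ 3 \<Longrightarrow>
        1 + (norm (A t) - 1) * D t $ 3 \<le> A t \<bullet> B t"
    and B_best: "t \<in> {0..<T} \<Longrightarrow> 0 < D t $ 3 \<Longrightarrow> b \<in> perimeter \<Longrightarrow> 1 \<le> A t \<bullet> b \<Longrightarrow>
        b = B t \<or> payoff_vec \<nu> (D t) (A t) b < payoff_vec \<nu> (D t) (A t) (B t)"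
    and heading: "t \<in> {0..<T} \<Longrightarrow> geodesic_direction (D t) (B t) (u t)"
    and speed: "t \<in> {0..<T} \<Longrightarrow> norm (w t) \<le> \<nu>"
begin

definition play_value :: "real \<Rightarrow> real" where
  "play_value t = payoff_vec \<nu> (D t) (A t) (B t)"

lemma D_continuous: "continuous_on {0..<T} D"
  by (rule first_order_motion_continuous[OF D_motion, of 1])
     (use heading in \<open>auto simp: geodesic_direction_def\<close>)

lemma A_continuous: "continuous_on {0..<T} A"
  by (rule first_order_motion_continuous[OF A_motion speed]) (use \<nu> in auto)

lemma A_lipschitz: "s \<in> {0..<T} \<Longrightarrow> t \<in> {0..<T} \<Longrightarrow> norm (A t - A s) \<le> \<nu> * \<bar>t - s\<bar>"
  by (rule first_order_motion_lipschitz[OF A_motion speed]) (use \<nu> in auto)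

section \<open>The defender stays above the ground\<close>

text \<open>
  The point of the perimeter nearest to the intruder is visible, so the optimal point can be better
  only by being farther from the defender.
\<close>

lemma B_farther_than_nearest:
  assumes t: "t \<in> {0..<T}" "0 < D t $ 3"
  shows "D t \<bullet> B t \<le> D t \<bullet> A t / norm (A t)"
proof -
  define b where "b = A t /\<^sub>R norm (A t)"
  note A1 = A_outside[OF t(1)]
  then have "A t \<noteq> 0"
    by auto
  have b: "b \<in> perimeter"
    using \<open>A t \<noteq> 0\<close> A_ground[OF t(1)] by (simp add: b_def perimeter_def)
  have "A t \<bullet> b = norm (A t)"
    using \<open>A t \<noteq> 0\<close> by (simp add: b_def dot_square_norm power2_eq_square)
  moreover have "norm (A t - b) \<le> norm (A t - B t)"
  proof -
    have "A t - b = (norm (A t) - 1) *\<^sub>R b"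
      using \<open>A t \<noteq> 0\<close> by (simp add: b_def left_diff_distrib scaleR_left_diff_distrib)
    then have "norm (A t - b) = norm (A t) - 1"
      using A1 b by (simp add: perimeter_def)
    also have "\<dots> \<le> norm (A t - B t)"
      using norm_triangle_ineq2[of "A t" "B t"] B_perimeter[OF t(1)] by (simp add: perimeter_def)
    finally show ?thesis .
  qed
  then have "norm (A t - b) / \<nu> \<le> norm (A t - B t) / \<nu>"
    using \<nu> by (simp add: divide_right_mono)
  moreover have "payoff_vec \<nu> (D t) (A t) b \<le> payoff_vec \<nu> (D t) (A t) (B t)"
    using B_best[OF t b] A1 \<open>A t \<bullet> b = norm (A t)\<close> by auto
  ultimately have "arccos (D t \<bullet> b) \<le> arccos (D t \<bullet> B t)"
    unfolding payoff_vec_def by linarith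
  then have "D t \<bullet> B t \<le> D t \<bullet> b"
    using abs_inner_perimeter_le_1[OF D_unit[OF t(1)]] b B_perimeter[OF t(1)]
    by (subst (asm) arccos_le_mono) blast+
  then show ?thesis
    by (simp add: b_def divide_inverse mult.commute)
qed

lemma heading_eq:
  assumes "t \<in> {0..<T}"
  shows "B t = (D t \<bullet> B t) *\<^sub>R D t + sqrt (1 - (D t \<bullet> B t)\<^sup>2) *\<^sub>R u t"
    and "norm (u t) = 1" and "D t \<bullet> u t = 0"
  using heading[OF assms] abs_inner_perimeter_le_1[OF D_unit B_perimeter, OF assms assms]
  by (simp_all add: geodesic_direction_def sin_arccos_abs)

text \<open>
  On the way to a perimeter point at geodesic distance \<open>d\<close>, the height \<open>z\<close> satisfies
  \<open>z' = - z cot d\<close>. So the height can only vanish in finite time if \<open>d\<close> tends to 0,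
  which \<open>B_farther_than_nearest\<close> excludes until the intruder is met.
\<close>

lemma D_positive:
  assumes "t \<in> {0..<T}"
  shows "0 < D t $ 3"
proof (rule ccontr)
  assume "\<not> 0 < D t $ 3"
  then have "D t $ 3 = 0"
    using D_nonneg[OF assms] by simp
  define Z where "Z = {s \<in> {0..t}. D s $ 3 = 0}"
  have sub: "{0..t} \<subseteq> {0..<T}"
    using assms by auto
  have "continuous_on {0..t} (\<lambda>s. D s $ 3)"
    by (intro continuous_intros continuous_on_subset[OF D_continuous sub])
  then have "closed Z"
    unfolding Z_def by (intro continuous_closed_preimage_constant) auto
  moreover have "t \<in> Z" "bdd_below Z"
    using assms \<open>D t $ 3 = 0\<close> by (auto simp: Z_def intro: bdd_belowI[of _ 0])
  ultimately have "Inf Z \<in> Z"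
    using closed_contains_Inf by blast
  \<comment> \<open>The first time on the ground. Optimality of \<open>B\<close> is available
    strictly before it.\<close>
  define \<tau> where "\<tau> = Inf Z"
  have \<tau>: "0 \<le> \<tau>" "\<tau> \<le> t" "D \<tau> $ 3 = 0" and \<tau>T: "\<tau> \<in> {0..<T}"
    using \<open>Inf Z \<in> Z\<close> assms by (auto simp: Z_def \<tau>_def)
  have \<tau>0: "0 < \<tau>"
    using \<tau> D_start by (cases "\<tau> = 0") auto
  have before: "0 < D s $ 3" if "0 \<le> s" "s < \<tau>" for s
  proof -
    have "s \<notin> Z"
      using that cInf_lower[OF _ \<open>bdd_below Z\<close>, of s] by (auto simp: \<tau>_def)
    then show ?thesis
      using that \<tau> D_nonneg[of s] assms by (auto simp: Z_def)
  qed
  \<comment> \<open>By \<open>apart\<close>, the defender is not at the perimeter point nearest to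
    the intruder, so Cauchy-Schwarz is strict.\<close>
  have "D \<tau> \<bullet> A \<tau> < norm (A \<tau>)"
  proof -
    have "D \<tau> \<bullet> A \<tau> \<le> norm (A \<tau>)"
      using norm_cauchy_schwarz[of "D \<tau>" "A \<tau>"] D_unit[OF \<tau>T] by simp
    moreover have "D \<tau> \<bullet> A \<tau> \<noteq> norm (A \<tau>)"
      using norm_cauchy_schwarz_eq[of "D \<tau>" "A \<tau>"] D_unit[OF \<tau>T] apart[OF \<tau>T]
      by (metis mult_1 scaleR_one)
    ultimately show ?thesis by simp
  qed
  then have "D \<tau> \<bullet> A \<tau> / norm (A \<tau>) < 1"
    using A_outside[OF \<tau>T] by (subst divide_less_eq) auto
  \<comment> \<open>The gap below \<open>c\<close> lets the bound persist near \<tau>; the maximum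
    with 0 makes \<open>c\<close> and \<open>C\<close> positive.\<close>
  then obtain c where c: "D \<tau> \<bullet> A \<tau> / norm (A \<tau>) < c" "0 < c" "c < 1"
    using dense[of "max (D \<tau> \<bullet> A \<tau> / norm (A \<tau>)) 0" 1] by auto
  \<comment> \<open>\<open>C\<close> is the cotangent of \<open>arccos c\<close>, hence an upper
    bound for cot d as long as cos d is below \<open>c\<close>.\<close>
  define C where "C = c / sqrt (1 - c\<^sup>2)"
  have c2: "0 < 1 - c\<^sup>2"
    using c by (simp add: abs_square_less_1)
  then have C: "0 < C"
    using c by (simp add: C_def)
  have "continuous_on {0..<T} (\<lambda>s. D s \<bullet> A s / norm (A s))"
    using A_outside by (intro continuous_intros D_continuous A_continuous) force
  then have "((\<lambda>s. D s \<bullet> A s / norm (A s)) \<longlongrightarrow> D \<tau> \<bullet> A \<tau> / norm (A \<tau>)) (at \<tau> within {0..<T})"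
    using \<tau>T by (simp add: continuous_on_def)
  then have "\<forall>\<^sub>F s in at \<tau> within {0..<T}. D s \<bullet> A s / norm (A s) < c"
    using c(1) by (rule order_tendstoD)
  then obtain \<delta> where \<delta>: "0 < \<delta>"
    "\<And>s. s \<in> {0..<T} \<Longrightarrow> s \<noteq> \<tau> \<Longrightarrow> dist s \<tau> < \<delta> \<Longrightarrow> D s \<bullet> A s / norm (A s) < c"
    unfolding eventually_at by blast
  have rate: "- C * D s $ 3 \<le> u s $ 3" if s: "0 \<le> s" "s < \<tau>" "\<tau> - \<delta> < s" for s
  proof -
    define k where "k = D s \<bullet> B s"
    have sT: "s \<in> {0..<T}" using s \<tau>T by auto
    have D3: "0 < D s $ 3" using before s by auto
    have k1: "\<bar>k\<bar> < 1"
      unfolding k_def using D3 by (intro abs_inner_perimeter_less_1 D_unit B_perimeter sT) auto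
    then have root: "0 < sqrt (1 - k\<^sup>2)"
      by (simp add: abs_square_less_1)
    have "k \<le> D s \<bullet> A s / norm (A s)"
      unfolding k_def by (rule B_farther_than_nearest[OF sT D3])
    also have "\<dots> < c"
      using \<delta>(2)[OF sT] s by (simp add: dist_real_def)
    finally have "k < c" .
    have "0 = (k *\<^sub>R D s + sqrt (1 - k\<^sup>2) *\<^sub>R u s) $ 3"
      using heading_eq(1)[OF sT] B_perimeter[OF sT] by (simp add: perimeter_def k_def)
    then have u3: "u s $ 3 = - (k / sqrt (1 - k\<^sup>2) * D s $ 3)"
      using root by (simp add: field_simps)
    have "k / sqrt (1 - k\<^sup>2) \<le> C"
    proof (cases "0 \<le> k")
      case True
      then have "k\<^sup>2 \<le> c\<^sup>2"
        using \<open>k < c\<close> by (simp add: power_mono)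
      then show ?thesis
        unfolding C_def using True \<open>k < c\<close> c2 by (intro frac_le) auto
    next
      case False
      then show ?thesis
        using root C by (smt (verit) divide_neg_pos)
    qed
    then have "k / sqrt (1 - k\<^sup>2) * D s $ 3 \<le> C * D s $ 3"
      using D3 by (intro mult_right_mono) auto
    then show ?thesis
      unfolding u3 by linarith
  qed
  \<comment> \<open>Close enough to \<tau> for \<open>rate\<close> to apply from \<sigma> on, and
    for the height to lose at most half of its maximum before \<tau>.\<close>
  define \<sigma> where "\<sigma> = max (max 0 (\<tau> - \<delta> / 2)) (\<tau> - 1 / (2 * C))"
  have \<sigma>: "0 \<le> \<sigma>" "\<sigma> < \<tau>" "\<tau> - \<delta> < \<sigma>" "C * (\<tau> - \<sigma>) \<le> 1 / 2"
  proof -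
    show "0 \<le> \<sigma>" "\<sigma> < \<tau>" "\<tau> - \<delta> < \<sigma>"
      using \<tau>0 \<delta>(1) C by (auto simp: \<sigma>_def less_max_iff_disj)
    have "\<tau> - \<sigma> \<le> 1 / (2 * C)"
      by (simp add: \<sigma>_def)
    then show "C * (\<tau> - \<sigma>) \<le> 1 / 2"
      using C by (simp add: field_simps)
  qed
  \<comment> \<open>A substitute for Gronwall's inequality, as \<open>u\<close> is so far only
    integrable: from a point \<open>m\<close> of maximal height on \<open>{\<sigma>..s}\<close>, the
    height falls at rate at most \<open>C * D m $ 3\<close>, for a time of at most
    \<open>1 / (2 * C)\<close>.\<close>
  have half: "D \<sigma> $ 3 / 2 \<le> D s $ 3" if s: "\<sigma> \<le> s" "s < \<tau>" for s
  proof -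
    have sub: "{\<sigma>..s} \<subseteq> {0..<T}"
      using \<sigma> s \<tau>T by auto
    have cont: "continuous_on {\<sigma>..s} (\<lambda>s. D s $ 3)"
      by (intro continuous_intros continuous_on_subset[OF D_continuous sub])
    have "{\<sigma>..s} \<noteq> {}"
      using s by simp
    then obtain m where m: "m \<in> {\<sigma>..s}" "\<And>y. y \<in> {\<sigma>..s} \<Longrightarrow> D y $ 3 \<le> D m $ 3"
      using continuous_attains_sup[OF compact_Icc _ cont] by blast
    have Du: "(u has_integral (D s - D m)) {m..s}"
      using m \<sigma> s \<tau>T by (intro first_order_motion_has_integral[OF D_motion]) auto
    have Du3: "((\<lambda>x. u x $ 3) has_integral (D s $ 3 - D m $ 3)) {m..s}"
      using has_integral_linear[OF Du bounded_linear_vec_nth[of 3]] by (simp add: o_def)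
    have const: "((\<lambda>x. - C * D m $ 3) has_integral (s - m) * (- C * D m $ 3)) {m..s}"
      using has_integral_const_real[of "- C * D m $ 3" m s] m by simp
    have "- C * D m $ 3 \<le> u x $ 3" if "x \<in> {m..s}" for x
    proof -
      have "- C * D m $ 3 \<le> - C * D x $ 3"
        using m(2)[of x] that m(1) C by auto
      also have "\<dots> \<le> u x $ 3"
        using that m(1) \<sigma> s by (intro rate) auto
      finally show ?thesis .
    qed
    then have "(s - m) * (- C * D m $ 3) \<le> D s $ 3 - D m $ 3"
      by (rule has_integral_le[OF const Du3])
    moreover have "(C * (s - m)) * D m $ 3 \<le> (C * (\<tau> - \<sigma>)) * D m $ 3"
      using m \<sigma> s C before[of m] by (intro mult_right_mono mult_left_mono) auto
    moreover have "(C * (\<tau> - \<sigma>)) * D m $ 3 \<le> (1 / 2) * D m $ 3"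
      using \<sigma>(1,4) m s before[of m] by (intro mult_right_mono) auto
    ultimately have "D m $ 3 / 2 \<le> D s $ 3"
      by (simp add: algebra_simps)
    then show ?thesis
      using m(2)[of \<sigma>] s by simp
  qed
  have "D \<sigma> $ 3 / 2 \<le> D \<tau> $ 3"
  proof (rule tendsto_lowerbound)
    have "{0..\<tau>} \<subseteq> {0..<T}"
      using \<tau>T by auto
    then have "continuous_on {0..\<tau>} (\<lambda>s. D s $ 3)"
      by (intro continuous_intros continuous_on_subset[OF D_continuous])
    then have "((\<lambda>s. D s $ 3) \<longlongrightarrow> D \<tau> $ 3) (at \<tau> within {0..\<tau>})"
      using \<tau>0 by (simp add: continuous_on_def)
    then show "((\<lambda>s. D s $ 3) \<longlongrightarrow> D \<tau> $ 3) (at_left \<tau>)"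
      using \<tau>0 by (simp add: at_within_Icc_at_left)
    show "\<forall>\<^sub>F s in at_left \<tau>. D \<sigma> $ 3 / 2 \<le> D s $ 3"
      using eventually_at_left_real[OF \<sigma>(2)] by eventually_elim (use half in auto)
  qed simp
  then show False
    using \<tau>(3) before[of \<sigma>] \<sigma> by simp
qed

section \<open>Continuity of the value, the optimal point and the control\<close>

text \<open>The visibility margin at time \<open>t\<close> absorbs the intruder's displacement, so
  \<open>B t\<close> is also visible from \<open>A s\<close> and competes with \<open>B s\<close>
  there. What remains compares travel times to the same point. The order of \<open>s\<close> and
  \<open>t\<close> is left open, so that the bound can be used in both directions for
  continuity.\<close>

lemma play_value_diff_le:
  assumes s: "s \<in> {0..<T}" and t: "t \<in> {0..<T}"
    and near: "norm (A t - A s) \<le> (norm (A t) - 1) * D t $ 3"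
  shows "play_value t - play_value s \<le>
    arccos (D t \<bullet> B t) - arccos (D s \<bullet> B t) + norm (A t - A s) / \<nu>"
proof -
  have "norm (B t) = 1"
    using B_perimeter[OF t] by (simp add: perimeter_def)
  then have "(A t - A s) \<bullet> B t \<le> norm (A t - A s)"
    using norm_cauchy_schwarz[of "A t - A s" "B t"] by simp
  then have "1 \<le> A s \<bullet> B t"
    using B_visible[OF t D_positive[OF t]] near by (simp add: inner_diff_left)
  then have "payoff_vec \<nu> (D s) (A s) (B t) \<le> play_value s"
    unfolding play_value_def using B_best[OF s D_positive[OF s] B_perimeter[OF t]] by fastforce
  moreover have "norm (A s - B t) / \<nu> \<le> (norm (A t - B t) + norm (A t - A s)) / \<nu>"
    using \<nu> norm_triangle_ineq4[of "A t - B t" "A t - A s"] by (intro divide_right_mono) auto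
  ultimately show ?thesis
    unfolding play_value_def payoff_vec_def by (simp add: add_divide_distrib)
qed

lemma visibility_margin_pos: "t \<in> {0..<T} \<Longrightarrow> 0 < (norm (A t) - 1) * D t $ 3"
  using A_outside D_positive by simp

text \<open>Increments in both directions are bounded by \<open>play_value_diff_le\<close>. Uniform
  continuity of \<open>arccos\<close> serves because one direction involves \<open>B s\<close>,
  whose continuity is derived only afterwards, from this lemma.\<close>

lemma play_value_continuous: "continuous_on {0..<T} play_value"
  unfolding continuous_on_def
proof
  fix t assume t: "t \<in> {0..<T}"
  let ?F = "at t within {0..<T}"
  let ?m = "\<lambda>s. (norm (A s) - 1) * D s $ 3"
  have D: "(D \<longlongrightarrow> D t) ?F" and A: "(A \<longlongrightarrow> A t) ?F"
    using D_continuous A_continuous t by (auto simp: continuous_on_def)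
  have D': "((\<lambda>s. norm (D s - D t)) \<longlongrightarrow> 0) ?F" and A': "((\<lambda>s. norm (A t - A s)) \<longlongrightarrow> 0) ?F"
    using D A tendsto_diff[OF tendsto_const[of "A t"] A] by (auto intro: tendsto_norm_zero LIM_zero)
  show "(play_value \<longlongrightarrow> play_value t) ?F"
  proof (rule tendstoI)
    fix e :: real assume "0 < e"
    have "uniformly_continuous_on {-1..1} arccos"
      by (intro compact_uniformly_continuous continuous_on_arccos') auto
    then obtain d where d: "0 < d"
      "\<And>x y. x \<in> {-1..1} \<Longrightarrow> y \<in> {-1..1} \<Longrightarrow> \<bar>x - y\<bar> < d \<Longrightarrow> \<bar>arccos x - arccos y\<bar> < e / 2"
      unfolding uniformly_continuous_on_def dist_real_def using half_gt_zero[OF \<open>0 < e\<close>] by metis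
    have "\<forall>\<^sub>F s in ?F. norm (D s - D t) < d"
      using D' d(1) by (rule order_tendstoD)
    moreover have "\<forall>\<^sub>F s in ?F. norm (A t - A s) < \<nu> * (e / 2)"
      by (rule order_tendstoD[OF A']) (use \<nu> \<open>0 < e\<close> in simp)
    moreover have "\<forall>\<^sub>F s in ?F. norm (A t - A s) < ?m t"
      using A' visibility_margin_pos[OF t] by (rule order_tendstoD)
    moreover have "\<forall>\<^sub>F s in ?F. 0 < ?m s - norm (A t - A s)"
    proof (rule order_tendstoD)
      show "((\<lambda>s. ?m s - norm (A t - A s)) \<longlongrightarrow> ?m t - 0) ?F"
        by (intro tendsto_intros A' D A)
    qed (use visibility_margin_pos[OF t] in simp)
    moreover have "\<forall>\<^sub>F s in ?F. s \<in> {0..<T}"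
      by (auto simp: eventually_at_filter)
    ultimately show "\<forall>\<^sub>F s in ?F. dist (play_value s) (play_value t) < e"
    proof eventually_elim
      case (elim s)
      have arc: "\<bar>arccos (D s \<bullet> b) - arccos (D t \<bullet> b)\<bar> < e / 2" if b: "b \<in> perimeter" for b
      proof (rule d(2))
        show "D s \<bullet> b \<in> {-1..1}" "D t \<bullet> b \<in> {-1..1}"
          using abs_inner_perimeter_le_1[OF D_unit b] elim(5) t by (auto simp: abs_le_iff)
        have "\<bar>D s \<bullet> b - D t \<bullet> b\<bar> \<le> norm (D s - D t)"
          using Cauchy_Schwarz_ineq2[of "D s - D t" b] b
          by (simp add: perimeter_def inner_diff_left)
        then show "\<bar>D s \<bullet> b - D t \<bullet> b\<bar> < d"
          using elim(1) by linarith
      qed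
      have A2: "norm (A t - A s) / \<nu> < e / 2"
        using elim(2) \<nu> by (simp add: field_simps)
      have "play_value t - play_value s < e"
        using play_value_diff_le[OF elim(5) t] elim(3) arc[OF B_perimeter[OF t]] A2 by linarith
      moreover have "play_value s - play_value t < e"
        using play_value_diff_le[OF t elim(5)] elim(4) arc[OF B_perimeter[OF elim(5)]] A2
        unfolding norm_minus_commute[of "A s"] by linarith
      ultimately show ?case
        by (simp add: dist_real_def abs_less_iff)
    qed
  qed
qed

text \<open>Strict optimality identifies the graph of \<open>B\<close> as a closed set over a compact range.\<close>

lemma B_continuous:
  assumes "c < T"
  shows "continuous_on {0..c} B"
proof (rule continuous_from_closed_graph[OF compact_perimeter])
  have sub: "{0..c} \<subseteq> {0..<T}"
    using assms by auto
  then show "B \<in> {0..c} \<rightarrow> perimeter"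
    using B_perimeter by blast
  let ?K = "{0..c} \<times> perimeter"
  let ?P = "\<lambda>z. payoff_vec \<nu> (D (fst z)) (A (fst z)) (snd z)"
  \<comment> \<open>By \<open>B_best\<close>, a visible point whose payoff reaches
    \<open>play_value t\<close> is \<open>B t\<close>. The right side consists of weak inequalities
    between continuous functions, so it is closed.\<close>
  have "(\<lambda>t. (t, B t)) ` {0..c} =
      {z \<in> ?K. 1 \<le> A (fst z) \<bullet> snd z} \<inter> {z \<in> ?K. play_value (fst z) \<le> ?P z}" (is "?G = ?R")
  proof
    show "?G \<subseteq> ?R"
    proof
      fix z assume "z \<in> ?G"
      then obtain t where t: "t \<in> {0..c}" "z = (t, B t)"
        by blast
      then have tT: "t \<in> {0..<T}"
        using sub by blast
      have "1 \<le> A t \<bullet> B t"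
        using B_visible[OF tT D_positive[OF tT]] visibility_margin_pos[OF tT] by linarith
      then show "z \<in> ?R"
        using t B_perimeter[OF tT] by (simp add: play_value_def)
    qed
    show "?R \<subseteq> ?G"
    proof
      fix z assume z: "z \<in> ?R"
      then have z': "fst z \<in> {0..c}" "snd z \<in> perimeter" "1 \<le> A (fst z) \<bullet> snd z"
          "play_value (fst z) \<le> ?P z"
        by (simp_all add: mem_Times_iff)
      then have tT: "fst z \<in> {0..<T}"
        using sub by blast
      have "snd z = B (fst z)"
        using B_best[OF tT D_positive[OF tT] z'(2,3)] z'(4) unfolding play_value_def by linarith
      then show "z \<in> ?G"
        by (intro image_eqI[OF _ z'(1)]) (simp add: prod_eq_iff)
    qed
  qed
  moreover have "closed ?R"
  proof -
    have fst: "continuous_on ?K (\<lambda>z. f (fst z))" if "continuous_on {0..<T} f"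
      for f :: "real \<Rightarrow> 'b::topological_space"
    proof (rule continuous_on_compose2[OF that])
      show "fst ` ?K \<subseteq> {0..<T}"
        using sub by auto
    qed (rule continuous_on_fst[OF continuous_on_id])
    have "closed ?K"
      by (intro closed_Times compact_imp_closed compact_perimeter compact_Icc)
    moreover have "continuous_on ?K (\<lambda>z. A (fst z) \<bullet> snd z)"
      by (intro continuous_intros fst A_continuous)
    moreover have "continuous_on ?K ?P"
    proof -
      have "-1 \<le> D (fst z) \<bullet> snd z \<and> D (fst z) \<bullet> snd z \<le> 1" if "z \<in> ?K" for z
      proof -
        have "\<bar>D (fst z) \<bullet> snd z\<bar> \<le> 1"
          using that sub by (intro abs_inner_perimeter_le_1 D_unit) auto
        then show ?thesis
          by linarith
      qed
      then show ?thesis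
        unfolding payoff_vec_def using \<nu>
        by (intro continuous_intros fst A_continuous D_continuous) auto
    qed
    moreover have "continuous_on ?K (\<lambda>z. play_value (fst z))"
      by (intro fst play_value_continuous)
    ultimately show ?thesis
      by (intro closed_Int continuous_on_closed_Collect_le continuous_on_const)
  qed
  ultimately show "closed ?G"
    by (simp only:)
qed

lemma abs_inner_B_less_1: "t \<in> {0..<T} \<Longrightarrow> \<bar>D t \<bullet> B t\<bar> < 1"
  using D_positive[of t] by (intro abs_inner_perimeter_less_1 D_unit B_perimeter) auto

text \<open>\<open>heading_eq\<close> can be solved for the control because its coefficient
  \<open>sqrt (1 - (D t \<bullet> B t)\<^sup>2)\<close> never vanishes. Continuity upgrades the
  integrated dynamics of \<open>D\<close> to a derivative at every time.\<close>

lemma u_continuous: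
  assumes "c < T"
  shows "continuous_on {0..c} u"
proof -
  have sub: "{0..c} \<subseteq> {0..<T}"
    using assms by auto
  let ?k = "\<lambda>t. D t \<bullet> B t"
  let ?u = "\<lambda>t. (B t - ?k t *\<^sub>R D t) /\<^sub>R sqrt (1 - (?k t)\<^sup>2)"
  have root: "0 < 1 - (?k t)\<^sup>2" if "t \<in> {0..c}" for t
    using abs_inner_B_less_1[of t] sub that by (auto simp: abs_square_less_1)
  have cont: "continuous_on {0..c} ?u"
    by (intro continuous_intros B_continuous[OF assms] continuous_on_subset[OF D_continuous sub])
       (use root in force)
  have "?u t = u t" if t: "t \<in> {0..c}" for t
  proof -
    have "B t - ?k t *\<^sub>R D t = sqrt (1 - (?k t)\<^sup>2) *\<^sub>R u t"
      using heading_eq(1)[of t] t sub by (simp add: diff_eq_eq add.commute subset_iff)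
    then show ?thesis
      using root[OF t] by simp
  qed
  then show ?thesis
    by (rule continuous_on_eq[OF cont])
qed

section \<open>Decrease of the payoff\<close>

lemma D_has_derivative:
  assumes "t \<in> {0..c}" "c < T"
  shows "(D has_vector_derivative u t) (at t within {0..c})"
proof -
  have D: "((\<lambda>s. D 0 + integral {0..s} u) has_vector_derivative u t) (at t within {0..c})"
    using has_vector_derivative_add[OF has_vector_derivative_const
        integral_has_vector_derivative[OF u_continuous[OF assms(2)] assms(1)]]
    by simp
  have "D s = D 0 + integral {0..s} u" if "s \<in> {0..c}" for s
    using integral_unique[OF first_order_motion_has_integral[OF D_motion, of 0 s]] that assms
    by simp
  then show ?thesis
    by (rule has_vector_derivative_transform[OF assms(1) _ D])
qed

text \<open>With the target frozen, the cosine of the geodesic distance d grows at rate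
  \<open>u t \<bullet> B t\<close>, which equals sin d at the time \<open>t\<close> of freezing; so
  d falls at rate 1 there.\<close>

lemma travel_time_has_derivative:
  assumes t: "t \<in> {0..c}" "c < T"
  shows "((\<lambda>s. arccos (D s \<bullet> B t)) has_real_derivative -1) (at t within {0..c})"
proof -
  have tT: "t \<in> {0..<T}"
    using t by auto
  let ?k = "D t \<bullet> B t"
  let ?q = "sqrt (1 - ?k\<^sup>2)"
  have k: "-1 < ?k" "?k < 1" and q: "0 < ?q"
    using abs_inner_B_less_1[OF tT] by (auto simp: abs_less_iff abs_square_less_1)
  have "u t \<bullet> B t = u t \<bullet> (?k *\<^sub>R D t + ?q *\<^sub>R u t)"
    by (rule arg_cong[where f = "inner (u t)", OF heading_eq(1)[OF tT]])
  also have "\<dots> = ?q"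
    using heading_eq(2,3)[OF tT]
    by (simp add: inner_add_right inner_commute[of "u t" "D t"] dot_square_norm)
  finally have "u t \<bullet> B t = ?q" .
  moreover have "((\<lambda>s. D s \<bullet> B t) has_real_derivative u t \<bullet> B t) (at t within {0..c})"
    unfolding has_real_derivative_iff_has_vector_derivative
    by (rule bounded_linear.has_vector_derivative[OF bounded_linear_inner_left D_has_derivative[OF t]])
  ultimately have "((\<lambda>s. arccos (D s \<bullet> B t)) has_real_derivative
      inverse (- ?q) * ?q) (at t within {0..c})"
    using DERIV_chain2[of arccos _ "\<lambda>s. D s \<bullet> B t" t, OF DERIV_arccos[OF k]] by simp
  then show ?thesis
    using q by simp
qed

text \<open>For \<open>s\<close> just below \<open>t\<close>, the defender's term in
  \<open>play_value_diff_le\<close> is at most \<open>(-1 + \<epsilon>) * (t - s)\<close>, and the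
  intruder's is at most \<open>t - s\<close> by the speed bound.\<close>

lemma play_value_left_Dini:
  assumes "0 \<le> a" "a < t" "t < T" "0 < \<epsilon>"
  shows "\<exists>s\<in>{a..<t}. play_value t - play_value s \<le> \<epsilon> * (t - s)"
proof -
  let ?F = "at t within {0..t}"
  let ?f = "\<lambda>s. arccos (D s \<bullet> B t)"
  have t: "t \<in> {0..<T}"
    using assms by auto
  have "((\<lambda>s. (?f s - ?f t) / (s - t)) \<longlongrightarrow> -1) ?F"
    using travel_time_has_derivative[of t t] assms by (simp add: has_field_derivative_iff)
  then have "\<forall>\<^sub>F s in ?F. (?f s - ?f t) / (s - t) < -1 + \<epsilon>"
    by (rule order_tendstoD) (use assms in simp)
  moreover have "\<forall>\<^sub>F s in ?F. norm (A t - A s) < (norm (A t) - 1) * D t $ 3"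
  proof (rule order_tendstoD(2)[OF _ visibility_margin_pos[OF t]])
    have "{0..t} \<subseteq> {0..<T}"
      using assms by auto
    then have "continuous_on {0..t} A"
      by (rule continuous_on_subset[OF A_continuous])
    then have "(A \<longlongrightarrow> A t) ?F"
      using assms by (simp add: continuous_on_def)
    then show "((\<lambda>s. norm (A t - A s)) \<longlongrightarrow> 0) ?F"
      by (auto intro!: tendsto_eq_intros)
  qed
  ultimately have "\<forall>\<^sub>F s in ?F. (?f s - ?f t) / (s - t) < -1 + \<epsilon> \<and>
      norm (A t - A s) < (norm (A t) - 1) * D t $ 3"
    by (rule eventually_conj)
  then obtain \<delta> where \<delta>: "0 < \<delta>"
    "\<And>s. s \<in> {0..t} \<Longrightarrow> s \<noteq> t \<Longrightarrow> dist s t < \<delta> \<Longrightarrow>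
      (?f s - ?f t) / (s - t) < -1 + \<epsilon> \<and> norm (A t - A s) < (norm (A t) - 1) * D t $ 3"
    unfolding eventually_at by blast
  define s where "s = max a (t - \<delta> / 2)"
  have s: "a \<le> s" "s < t" "t - \<delta> < s"
    using assms \<delta>(1) by (auto simp: s_def)
  then have sT: "s \<in> {0..<T}"
    using assms by auto
  have slope: "(?f s - ?f t) / (s - t) < -1 + \<epsilon>"
    and near: "norm (A t - A s) < (norm (A t) - 1) * D t $ 3"
    using \<delta>(2)[of s] s assms by (auto simp: dist_real_def)
  have "play_value t - play_value s \<le> ?f t - ?f s + norm (A t - A s) / \<nu>"
    using near by (intro play_value_diff_le sT t) simp
  moreover have "norm (A t - A s) / \<nu> \<le> t - s"
    using A_lipschitz[OF sT t] s \<nu> by (simp add: field_simps)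
  moreover have "?f t - ?f s \<le> (-1 + \<epsilon>) * (t - s)"
    using slope s by (simp add: field_simps)
  ultimately have "play_value t - play_value s \<le> \<epsilon> * (t - s)"
    by (simp add: algebra_simps)
  then show ?thesis
    using s by auto
qed

lemma play_value_antimono: "antimono_on {0..<T} play_value"
proof (rule monotone_onI)
  fix s t assume st: "s \<in> {0..<T}" "t \<in> {0..<T}" "s \<le> t"
  show "play_value t \<le> play_value s"
  proof (rule left_Dini_nonpos_imp_le[OF st(3)])
    show "continuous_on {s..t} play_value"
      by (rule continuous_on_subset[OF play_value_continuous]) (use st in auto)
  next
    fix x \<epsilon> :: real assume "s < x" "x \<le> t" "0 < \<epsilon>"
    then show "\<exists>y\<in>{s..<x}. play_value x - play_value y \<le> \<epsilon> * (x - y)"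
      using st by (intro play_value_left_Dini) auto
  qed
qed

end

section \<open>Translation to spherical coordinates\<close>

lemma sph_nth [simp]:
  "sph az el \<rho> $ 1 = \<rho> * cos el * cos az"
  "sph az el \<rho> $ 2 = \<rho> * cos el * sin az"
  "sph az el \<rho> $ 3 = \<rho> * sin el"
  by (simp_all add: sph_def)

lemma inner_sph_ground: "sph az el \<rho> \<bullet> sph x 0 \<rho>' = \<rho> * \<rho>' * cos el * cos (x - az)"
  by (simp add: inner_vec_def sum_3 cos_diff algebra_simps)

lemma norm_sph: "norm (sph az el \<rho>) = \<bar>\<rho>\<bar>"
proof (rule power2_eq_imp_eq)
  have "(norm (sph az el \<rho>))\<^sup>2 =
      (\<rho> * cos el)\<^sup>2 * ((cos az)\<^sup>2 + (sin az)\<^sup>2) + (\<rho> * sin el)\<^sup>2"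
    unfolding power2_norm_eq_inner inner_vec_def sum_3 sph_nth
    by (simp only: power2_eq_square inner_real_def) algebra
  also have "\<dots> = \<rho>\<^sup>2 * ((sin el)\<^sup>2 + (cos el)\<^sup>2)"
    by (simp only: sin_cos_squared_add2 mult_1_right power_mult_distrib) algebra
  finally show "(norm (sph az el \<rho>))\<^sup>2 = \<bar>\<rho>\<bar>\<^sup>2"
    by simp
qed auto

lemma perimeter_eq_sph:
  assumes "b \<in> perimeter"
  obtains x where "b = sph x 0 1"
proof -
  have "(norm b)\<^sup>2 = 1" "b $ 3 = 0"
    using assms by (simp_all add: perimeter_def)
  then have "(b $ 1)\<^sup>2 + (b $ 2)\<^sup>2 = 1"
    unfolding power2_norm_eq_inner by (simp add: inner_vec_def sum_3 power2_eq_square)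
  then obtain x where "b $ 1 = cos x" "b $ 2 = sin x"
    using sincos_total_2pi by metis
  then have "b = sph x 0 1"
    using \<open>b $ 3 = 0\<close> by (simp add: vec_eq_iff forall_3)
  then show thesis by (rule that)
qed

lemma norm_diff_sph_ground:
  "norm (sph az 0 r - sph x 0 1) = sqrt (r\<^sup>2 + 1 - 2 * r * cos (x - az))"
  unfolding norm_eq_sqrt_inner inner_diff_left inner_diff_right inner_sph_ground
  by (simp add: power2_eq_square algebra_simps cos_diff)

lemma payoff_vec_sph:
  "payoff_vec \<nu> (sph \<psi>\<^sub>D \<phi> 1) (sph \<psi>\<^sub>A 0 r) (sph (\<psi>\<^sub>D + x) 0 1) = payoff \<nu> \<phi> (\<psi>\<^sub>A - \<psi>\<^sub>D) r x"
proof -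
  have "\<psi>\<^sub>D + x - \<psi>\<^sub>A = x - (\<psi>\<^sub>A - \<psi>\<^sub>D)"
    by simp
  then show ?thesis
    by (simp only: payoff_vec_def payoff_def inner_sph_ground norm_diff_sph_ground) simp
qed

lemma sph_ground_eq_iff: "sph x 0 1 = sph y 0 1 \<longleftrightarrow> [x = y] (rmod (2 * pi))"
  by (simp add: vec_eq_iff forall_3 rcong_2pi_iff)

text \<open>In vector form, the defender's capture condition says that the defender is at the radial
  projection of the intruder to the perimeter. This form supplies \<open>apart\<close> and does not
  mention azimuths, which are ambiguous at the pole.\<close>

lemma not_play_endedD:
  assumes "\<not> play_ended \<phi> (\<psi>\<^sub>A - \<psi>\<^sub>D) r" "\<phi> \<in> {0..pi / 2}"
  shows "1 < r" and "r *\<^sub>R sph \<psi>\<^sub>D \<phi> 1 \<noteq> sph \<psi>\<^sub>A 0 r"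
proof -
  show r: "1 < r"
    using assms(1) by (simp add: play_ended_def)
  show "r *\<^sub>R sph \<psi>\<^sub>D \<phi> 1 \<noteq> sph \<psi>\<^sub>A 0 r"
  proof
    assume eq: "r *\<^sub>R sph \<psi>\<^sub>D \<phi> 1 = sph \<psi>\<^sub>A 0 r"
    then have "sin \<phi> = 0"
      using r by (simp add: vec_eq_iff forall_3)
    then have "\<phi> = 0"
      using assms(2) sin_gt_zero[of \<phi>] pi_gt_zero by (cases "\<phi> = 0") auto
    then have "[\<psi>\<^sub>A = \<psi>\<^sub>D] (rmod (2 * pi))"
      using eq r by (simp add: vec_eq_iff forall_3 rcong_2pi_iff)
    then have "[\<psi>\<^sub>A - \<psi>\<^sub>D = \<psi>\<^sub>D - \<psi>\<^sub>D] (rmod (2 * pi))"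
      by (intro rcong_diff rcong_refl)
    then show False
      using assms(1) \<open>\<phi> = 0\<close> by (simp add: play_ended_def)
  qed
qed

lemma optimal_point_visible:
  assumes "0 < \<nu>" "\<nu> \<le> 1" "0 < \<phi>" "\<phi> \<le> pi / 2" "1 < r"
    and "unique_optimal_pair \<nu> \<phi> (\<psi>\<^sub>A - \<psi>\<^sub>D) r \<theta> \<beta>"
  shows "1 + (r - 1) * sin \<phi> \<le> sph \<psi>\<^sub>A 0 r \<bullet> sph (\<psi>\<^sub>D + \<theta>) 0 1"
proof -
  have "optimal_pair \<nu> \<phi> (\<psi>\<^sub>A - \<psi>\<^sub>D) r \<theta> \<beta>"
    using assms(6) by (simp add: unique_optimal_pair_def)
  moreover have "\<psi>\<^sub>D + \<theta> - \<psi>\<^sub>A = \<theta> - (\<psi>\<^sub>A - \<psi>\<^sub>D)"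
    by simp
  ultimately show ?thesis
    using optimal_pair_critical(2)[OF assms(1-5)] by (simp only: inner_sph_ground) simp
qed

lemma optimal_point_best:
  assumes "0 < \<nu>" "\<nu> \<le> 1" "0 < \<phi>" "\<phi> \<le> pi / 2" "1 < r"
    and "unique_optimal_pair \<nu> \<phi> (\<psi>\<^sub>A - \<psi>\<^sub>D) r \<theta> \<beta>"
    and "b \<in> perimeter" "1 \<le> sph \<psi>\<^sub>A 0 r \<bullet> b"
  shows "b = sph (\<psi>\<^sub>D + \<theta>) 0 1 \<or>
    payoff_vec \<nu> (sph \<psi>\<^sub>D \<phi> 1) (sph \<psi>\<^sub>A 0 r) b
      < payoff_vec \<nu> (sph \<psi>\<^sub>D \<phi> 1) (sph \<psi>\<^sub>A 0 r) (sph (\<psi>\<^sub>D + \<theta>) 0 1)"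
proof -
  obtain y where y: "b = sph y 0 1"
    using perimeter_eq_sph[OF assms(7)] by blast
  define x where "x = y - \<psi>\<^sub>D"
  have b: "b = sph (\<psi>\<^sub>D + x) 0 1"
    by (simp add: y x_def)
  have "\<psi>\<^sub>D + x - \<psi>\<^sub>A = x - (\<psi>\<^sub>A - \<psi>\<^sub>D)"
    by simp
  then have "1 \<le> r * cos (x - (\<psi>\<^sub>A - \<psi>\<^sub>D))"
    using assms(8) unfolding b inner_sph_ground by (simp only:) simp
  then show ?thesis
    unfolding b payoff_vec_sph sph_ground_eq_iff
    using visible_arc_optimum[OF assms(1-6)] by simp blast
qed

theorem lemma11:
  fixes \<nu> T :: real
    and z\<^sub>D z\<^sub>A u\<^sub>D u\<^sub>A :: "real \<Rightarrow> real^3"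
    and \<psi>\<^sub>D \<phi>\<^sub>D \<psi>\<^sub>A r \<theta> \<beta> :: "real \<Rightarrow> real"
  assumes "0 < \<nu>" and "\<nu> \<le> 1"
    and "\<And>t. t \<in> {0..<T} \<Longrightarrow> z\<^sub>D t = sph (\<psi>\<^sub>D t) (\<phi>\<^sub>D t) 1 \<and> \<phi>\<^sub>D t \<in> {0..pi / 2}"
    and "\<And>t. t \<in> {0..<T} \<Longrightarrow> z\<^sub>A t = sph (\<psi>\<^sub>A t) 0 (r t)"
    and "\<phi>\<^sub>D 0 > 0"
    and "\<And>t. t \<in> {0..<T} \<Longrightarrow> \<not> play_ended (\<phi>\<^sub>D t) (\<psi>\<^sub>A t - \<psi>\<^sub>D t) (r t)"
    and "\<And>t. t \<in> {0..<T} \<Longrightarrow>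
           unique_optimal_pair \<nu> (\<phi>\<^sub>D t) (\<psi>\<^sub>A t - \<psi>\<^sub>D t) (r t) (\<theta> t) (\<beta> t)"
    and "first_order_motion T z\<^sub>D u\<^sub>D"
    and "\<And>t. t \<in> {0..<T} \<Longrightarrow>
           geodesic_direction (z\<^sub>D t) (sph (\<psi>\<^sub>D t + \<theta> t) 0 1) (u\<^sub>D t)"
    and "first_order_motion T z\<^sub>A u\<^sub>A"
    and "\<And>t. t \<in> {0..<T} \<Longrightarrow> norm (u\<^sub>A t) \<le> \<nu>"
  shows "antimono_on {0..<T} (\<lambda>t. payoff \<nu> (\<phi>\<^sub>D t) (\<psi>\<^sub>A t - \<psi>\<^sub>D t) (r t) (\<theta> t))"
proof (cases "0 < T")
  case False
  then show ?thesis
    by (simp add: monotone_on_def)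
next
  case True
  have zD: "z\<^sub>D t = sph (\<psi>\<^sub>D t) (\<phi>\<^sub>D t) 1" "0 \<le> \<phi>\<^sub>D t" "\<phi>\<^sub>D t \<le> pi / 2" if "t \<in> {0..<T}" for t
    using assms(3)[OF that] by auto
  note zA = assms(4)
  have out: "1 < r t" "r t *\<^sub>R sph (\<psi>\<^sub>D t) (\<phi>\<^sub>D t) 1 \<noteq> sph (\<psi>\<^sub>A t) 0 (r t)"
    if "t \<in> {0..<T}" for t
    using not_play_endedD[OF assms(6)[OF that]] zD[OF that] by auto
  \<comment> \<open>The conditions on \<open>B\<close> in the locale presuppose positive height
    because the analysis of the payoff needs a positive elevation, which is assumed only at time 0;
    \<open>D_positive\<close> removes the proviso.\<close>
  have elev: "0 < \<phi>\<^sub>D t" if "t \<in> {0..<T}" "0 < z\<^sub>D t $ 3" for t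
    using that zD[OF that(1)] by (cases "\<phi>\<^sub>D t = 0") auto
  interpret pursuit \<nu> T z\<^sub>D z\<^sub>A "\<lambda>t. sph (\<psi>\<^sub>D t + \<theta> t) 0 1" u\<^sub>D u\<^sub>A
  proof
    show "0 < z\<^sub>D 0 $ 3"
      using zD[of 0] assms(5) True by (auto intro!: sin_gt_zero)
  next
    fix t assume t: "t \<in> {0..<T}"
    show "norm (z\<^sub>D t) = 1" "0 \<le> z\<^sub>D t $ 3"
      using zD[OF t] by (auto simp: norm_sph intro!: sin_ge_zero)
    show "1 < norm (z\<^sub>A t)" "z\<^sub>A t $ 3 = 0" "norm (z\<^sub>A t) *\<^sub>R z\<^sub>D t \<noteq> z\<^sub>A t"
      using out[OF t] by (auto simp: norm_sph zA[OF t] zD[OF t])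
    show "sph (\<psi>\<^sub>D t + \<theta> t) 0 1 \<in> perimeter"
      by (simp add: perimeter_def norm_sph)
    show "1 + (norm (z\<^sub>A t) - 1) * z\<^sub>D t $ 3 \<le> z\<^sub>A t \<bullet> sph (\<psi>\<^sub>D t + \<theta> t) 0 1" if "0 < z\<^sub>D t $ 3"
      using optimal_point_visible[OF assms(1,2) elev[OF t that] zD(3)[OF t] out(1)[OF t] assms(7)[OF t]]
        out(1)[OF t]
      by (simp add: zD(1)[OF t] zA[OF t] norm_sph)
    show "b = sph (\<psi>\<^sub>D t + \<theta> t) 0 1 \<or>
        payoff_vec \<nu> (z\<^sub>D t) (z\<^sub>A t) b < payoff_vec \<nu> (z\<^sub>D t) (z\<^sub>A t) (sph (\<psi>\<^sub>D t + \<theta> t) 0 1)"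
      if "0 < z\<^sub>D t $ 3" "b \<in> perimeter" "1 \<le> z\<^sub>A t \<bullet> b" for b
      using optimal_point_best[OF assms(1,2) elev[OF t that(1)] zD(3)[OF t] out(1)[OF t]
          assms(7)[OF t] that(2)] that(3)
      by (simp only: zD(1)[OF t] zA[OF t])
  qed (use assms in auto)
  have "play_value t = payoff \<nu> (\<phi>\<^sub>D t) (\<psi>\<^sub>A t - \<psi>\<^sub>D t) (r t) (\<theta> t)" if "t \<in> {0..<T}" for t
    by (simp only: play_value_def zD(1)[OF that] zA[OF that] payoff_vec_sph)
  then show ?thesis
    using play_value_antimono by (simp add: monotone_on_def)
qed

end
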